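(* For every integer $n\ge1$, the polynomial $Z_n(y;1,1,0,1;1)$ in the variable $y$ has all its roots in the open interval $]-1,0[$ of the real line. As a consequence, it is stable and log-concave.
   Context: A staircase tableau $\mathcal{T}$ of size $n$ is a Ferrers diagram of shape $(n,n-1,\dots,2,1)$ (English convention) whose boxes are either empty or labeled with one of $\alpha,\beta,\gamma,\delta$, such that: no box along the diagonal (the last box of each row) is empty; all boxes in the same row and to the left of a $\beta$ or a $\delta$ are empty; all boxes in the same column and above an $\alpha$ or a $\gamma$ are empty. The weight $\mathbf{w}(\mathcal{T})$ is a monomial in $\alpha,\beta,\gamma,\delta,q$. Every blank box is assigned $q$ or $1$ according to the closest labeled box to its right in its row and the closest labeled box below it in its column: if it sees a $\beta$ to its right it gets $1$; if it sees a $\delta$ to its right it gets $q$; if it sees an $\alpha$ or $\gamma$ to its right and an $\alpha$ or $\delta$ below it, it gets $1$; if it sees an $\alpha$ or $\gamma$ to its right and a $\beta$ or $\gamma$ below it, it gets $q$. Then $\mathbf{w}(\mathcal{T})$ is the product of all labels in all boxes. Let $t(\mathcal{T})$ be the number of labels $\alpha$ or $\delta$ along the diagonal of $\mathcal{T}$. The fugacity partition function is $$Z_n(y;\alpha,\beta,\gamma,\delta;q)=\sum_{\mathcal{T}\text{ of size }n}\mathbf{w}(\mathcal{T})\,y^{t(\mathcal{T})}.$$ Thus $Z_n(y;1,1,0,1;1)$ is the sum of $y^{t(\mathcal{T})}$ over all staircase tableaux $\mathcal{T}$ of size $n$ without any label $\gamma$. A univariate polynomial is called stable if it has no zero in the open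 upper half-plane of $\mathbb{C}$. A polynomial $\sum_k a_k y^k$ with nonnegative coefficients is called log-concave if $a_k^2\ge a_{k-1}a_{k+1}$ for all $k$. *)

theory Defs
  imports Complex_Main "HOL-Computational_Algebra.Polynomial"
begin

datatype label = Alpha | Beta | Gamma | Delta

text \<open>
  A box is a pair (row, column); both are counted from 0, rows downwards and columns to the
  right, so that row \<open>i\<close> of the staircase shape \<open>(n, n - 1, \<dots>, 1)\<close> has the columns
  \<open>0, \<dots>, n - 1 - i\<close>.
\<close>

definition boxes :: "nat \<Rightarrow> (nat \<times> nat) set" where
  "boxes n = {(i, j). i + j < n}"

definition diagonal :: "nat \<Rightarrow> (nat \<times> nat) set" where
  "diagonal n = {(i, j). i + j + 1 = n}"

text \<open>
  \<open>None\<close> marks an empty box. A filling is also required to be \<open>None\<close> outside the shape, so that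
  each tableau is represented by exactly one function.
\<close>

type_synonym filling = "nat \<times> nat \<Rightarrow> label option"

definition staircase_tableaux :: "nat \<Rightarrow> filling set" where
  "staircase_tableaux n = {T.
     (\<forall>b. b \<notin> boxes n \<longrightarrow> T b = None) \<and>
     (\<forall>b\<in>diagonal n. T b \<noteq> None) \<and>
     (\<forall>i j j'. T (i, j) \<in> {Some Beta, Some Delta} \<and> j' < j \<longrightarrow> T (i, j') = None) \<and>
     (\<forall>i j i'. T (i, j) \<in> {Some Alpha, Some Gamma} \<and> i' < i \<longrightarrow> T (i', j) = None)}"

text \<open>
  Labels of the closest labeled box to the right, resp. below. In a staircase tableau they exist
  for every empty box of the shape, because the diagonal is completely labeled.
\<close>

definition label_right :: "filling \<Rightarrow> nat \<times> nat \<Rightarrow> label" where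
  "label_right T = (\<lambda>(i, j). the (T (i, LEAST k. j < k \<and> T (i, k) \<noteq> None)))"

definition label_below :: "filling \<Rightarrow> nat \<times> nat \<Rightarrow> label" where
  "label_below T = (\<lambda>(i, j). the (T (LEAST k. i < k \<and> T (k, j) \<noteq> None, j)))"

definition blank_weight :: "'a::comm_semiring_1 \<Rightarrow> filling \<Rightarrow> nat \<times> nat \<Rightarrow> 'a" where
  "blank_weight q T b =
     (case label_right T b of
        Beta \<Rightarrow> 1
      | Delta \<Rightarrow> q
      | _ \<Rightarrow> if label_below T b \<in> {Alpha, Delta} then 1 else q)"

definition box_weight ::
  "'a::comm_semiring_1 \<Rightarrow> 'a \<Rightarrow> 'a \<Rightarrow> 'a \<Rightarrow> 'a \<Rightarrow> filling \<Rightarrow> nat \<times> nat \<Rightarrow> 'a" where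
  "box_weight \<alpha> \<beta> \<gamma> \<delta> q T b =
     (case T b of
        None \<Rightarrow> blank_weight q T b
      | Some Alpha \<Rightarrow> \<alpha>
      | Some Beta \<Rightarrow> \<beta>
      | Some Gamma \<Rightarrow> \<gamma>
      | Some Delta \<Rightarrow> \<delta>)"

definition tableau_weight ::
  "nat \<Rightarrow> 'a::comm_semiring_1 \<Rightarrow> 'a \<Rightarrow> 'a \<Rightarrow> 'a \<Rightarrow> 'a \<Rightarrow> filling \<Rightarrow> 'a" where
  "tableau_weight n \<alpha> \<beta> \<gamma> \<delta> q T = (\<Prod>b\<in>boxes n. box_weight \<alpha> \<beta> \<gamma> \<delta> q T b)"

definition tableau_t :: "nat \<Rightarrow> filling \<Rightarrow> nat" where
  "tableau_t n T = card {b \<in> diagonal n. T b \<in> {Some Alpha, Some Delta}}"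

text \<open>
  The fugacity partition function \<open>Z\<^sub>n(y; \<alpha>, \<beta>, \<gamma>, \<delta>; q)\<close>, as a polynomial in \<open>y\<close>; the other
  parameters are elements of an arbitrary commutative semiring.
\<close>

definition fugacity_Z ::
  "nat \<Rightarrow> 'a::comm_semiring_1 \<Rightarrow> 'a \<Rightarrow> 'a \<Rightarrow> 'a \<Rightarrow> 'a \<Rightarrow> 'a poly" where
  "fugacity_Z n \<alpha> \<beta> \<gamma> \<delta> q =
     (\<Sum>T\<in>staircase_tableaux n. monom (tableau_weight n \<alpha> \<beta> \<gamma> \<delta> q T) (tableau_t n T))"

definition stable_poly :: "complex poly \<Rightarrow> bool" where
  "stable_poly p \<longleftrightarrow> (\<forall>z. Im z > 0 \<longrightarrow> poly p z \<noteq> 0)"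

text \<open>The inequality for \<open>k = 0\<close> is omitted: it is trivial, as the coefficient of index \<open>-1\<close> is 0.\<close>

definition log_concave_poly :: "real poly \<Rightarrow> bool" where
  "log_concave_poly p \<longleftrightarrow>
     (\<forall>k. coeff p k \<ge> 0) \<and>
     (\<forall>k\<ge>1. (coeff p k)\<^sup>2 \<ge> coeff p (k - 1) * coeff p (k + 1))"

text \<open>The sum in \<^const>\<open>fugacity_Z\<close> and the product in \<^const>\<open>tableau_weight\<close> are finite.\<close>

lemma finite_boxes: "finite (boxes n)"
  by (rule finite_subset[of _ "{..<n} \<times> {..<n}"]) (auto simp: boxes_def)

lemma finite_staircase_tableaux: "finite (staircase_tableaux n)"
proof -
  have "(UNIV :: label option set) = {None, Some Alpha, Some Beta, Some Gamma, Some Delta}"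
    by (auto, metis label.exhaust option.exhaust)
  then have "finite (UNIV :: label option set)"
    by (metis finite.emptyI finite.insertI)
  from finite_set_of_finite_funs[OF finite_boxes this, of n None]
  show ?thesis
    by (rule rev_finite_subset) (auto simp: staircase_tableaux_def)
qed

end

theory Submission
  imports Defs "HOL-Computational_Algebra.Fundamental_Theorem_Algebra"
begin

text \<open>
  At \<open>\<gamma> = 0\<close> and \<open>\<alpha> = \<beta> = \<delta> = q = 1\<close> the weight of a tableau is 1 if it has no label \<open>\<gamma>\<close>, and 0
  otherwise (\<open>fugacity_Z_eq\<close>), so that \<open>Z\<^sub>n\<close> enumerates the tableaux without \<open>\<gamma>\<close> by \<open>t\<close>. Refine this
  enumeration to \<open>P\<^sub>n(u)\<close>, a polynomial in \<open>y\<close>, by a factor \<open>u\<close> for each row that contains neither \<open>\<beta>\<close>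
  nor \<open>\<delta>\<close>; then \<open>Z\<^sub>n = P\<^sub>n(1)\<close>. Labels in the first column are permitted precisely in such rows (and
  in the bottom row), and deleting that column gives the recurrence \<open>row_refined_Z_shift\<close>,
  \<open>2 P\<^sub>n\<^sub>+\<^sub>1(u) = (1 + y) (u + 2) P\<^sub>n(u + 2) - (1 - y) u P\<^sub>n(u)\<close>.
  By induction it turns into one in which \<open>u\<close> is fixed (\<open>row_refined_Z_rec\<close>):
  \<open>P\<^sub>n\<^sub>+\<^sub>1 = (1 + (1 + u + n) y + n y\<^sup>2) P\<^sub>n + y (1 - y\<^sup>2) P\<^sub>n'\<close>.

  This is an Eulerian type recurrence, and it preserves the location of the roots. Since \<open>P\<^sub>n\<close> has
  degree \<open>n\<close>, the term \<open>n y\<close> can be distributed over the \<open>n\<close> roots \<open>r\<close> of \<open>P\<^sub>n\<close>, and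
  \<open>P\<^sub>n\<^sub>+\<^sub>1 / (y P\<^sub>n) = 1 / y + 1 + u + (\<Sum>r. (1 + y) (1 - r) / (y - r))\<close>.
  If all \<open>r\<close> lie in \<open>]-1, 0[\<close> and \<open>u > 0\<close>, the right-hand side has an imaginary part of sign opposite to
  that of \<open>y\<close> when \<open>y\<close> is not real, and is positive when \<open>y\<close> is real and outside \<open>[-1, 0]\<close>; at
  \<open>y = -1\<close> its value is \<open>u\<close>. Also \<open>P\<^sub>n\<^sub>+\<^sub>1\<close> and \<open>P\<^sub>n\<close> agree at \<open>y = 0\<close>.
  So all roots of \<open>P\<^sub>n\<^sub>+\<^sub>1\<close> lie in \<open>]-1, 0[\<close> as well (\<open>roots_in_interval_step\<close>). No interlacing is involved, and multiple roots do no harm.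

  Stability is immediate. For log-concavity, a real polynomial with negative roots and positive
  leading coefficient is a product of factors \<open>X + a\<close> with \<open>a > 0\<close>, up to a positive constant, and
  multiplication by such a factor preserves log-concavity of sequences without internal zeros
  (\<open>log_concave_linear_factor\<close>).
\<close>

section \<open>Tableaux without \<open>\<gamma>\<close> and their first columns\<close>

text \<open>
  The rows that may receive a further label on the left: a \<open>\<beta>\<close> or \<open>\<delta>\<close> anywhere in a row forbids
  labels to its left, while \<open>\<alpha>\<close> and \<open>\<gamma>\<close> do not.
\<close>
definition free_rows :: "nat \<Rightarrow> filling \<Rightarrow> nat set" where
  "free_rows n T = {i. i < n \<and> (\<forall>j. T (i, j) \<notin> {Some Beta, Some Delta})}"

definition gamma_free_tableaux :: "nat \<Rightarrow> filling set" where
  "gamma_free_tableaux n = {T \<in> staircase_tableaux n. \<forall>b. T b \<noteq> Some Gamma}"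

text \<open>
  The label columns that may be placed to the left of a tableau, when \<open>A\<close> is the set of rows in
  which a label is permitted. Only the relative order of the elements of \<open>A\<close> matters, so that
  \<open>A\<close> can be built up by adding a new bottom row.
\<close>
definition columns :: "nat set \<Rightarrow> (nat \<Rightarrow> label option) set" where
  "columns A = {c. (\<forall>i. i \<notin> A \<longrightarrow> c i = None) \<and> (\<forall>i. c i \<noteq> Some Gamma) \<and>
     (\<forall>i i'. c i = Some Alpha \<and> i' < i \<longrightarrow> c i' = None)}"

text \<open>
  When a column with entries \<open>c\<close> is placed to the left of a tableau whose free rows (together with
  the new bottom row) form the set \<open>A\<close>, these are the rows that stay free.
\<close>
definition kept_rows :: "nat set \<Rightarrow> (nat \<Rightarrow> label option) \<Rightarrow> nat set" where
  "kept_rows A c = {i \<in> A. c i \<notin> {Some Beta, Some Delta}}"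

definition prepend_column :: "(nat \<Rightarrow> label option) \<Rightarrow> filling \<Rightarrow> filling" where
  "prepend_column c T = (\<lambda>(i, j). case j of 0 \<Rightarrow> c i | Suc k \<Rightarrow> T (i, k))"

lemma prepend_column_simps [simp]:
  "prepend_column c T (i, 0) = c i"
  "prepend_column c T (i, Suc j) = T (i, j)"
  by (simp_all add: prepend_column_def)

lemma finite_free_rows [simp]: "finite (free_rows n T)"
  by (simp add: free_rows_def)

lemma not_free_row_n [simp]: "n \<notin> free_rows n T"
  by (simp add: free_rows_def)

lemma finite_gamma_free_tableaux [simp]: "finite (gamma_free_tableaux n)"
  by (simp add: gamma_free_tableaux_def finite_staircase_tableaux)

lemma label_cases: "l = None \<or> l = Some Alpha \<or> l = Some Beta \<or> l = Some Gamma \<or> l = Some Delta"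
  by (metis label.exhaust option.exhaust)

text \<open>
  A new bottom box \<open>b\<close> that is empty or carries \<open>\<beta>\<close> or \<open>\<delta>\<close> does not restrict the boxes above it; an
  \<open>\<alpha>\<close> there forces all of them to be empty.
\<close>
lemma columns_insert:
  assumes "\<forall>a\<in>A. a < b"
  shows "columns (insert b A) =
    columns A \<union> ((\<lambda>c. c(b := Some Beta)) ` columns A \<union> ((\<lambda>c. c(b := Some Delta)) ` columns A
      \<union> {(\<lambda>_. None)(b := Some Alpha)}))" (is "?L = ?R")
proof
  have b: "b \<notin> A" using assms by auto
  show "?R \<subseteq> ?L"
  proof -
    have "c \<in> ?L" if "c \<in> columns A" for c
      using that by (auto simp: columns_def)
    moreover have "c(b := Some x) \<in> ?L" if "c \<in> columns A" "x = Beta \<or> x = Delta" for c x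
    proof -
      have "\<not> b < i" if "c i = Some Alpha" for i
        using that \<open>c \<in> columns A\<close> assms by (auto simp: columns_def dest!: spec[of _ i])
      with that show ?thesis by (fastforce simp: columns_def)
    qed
    moreover have "(\<lambda>_. None)(b := Some Alpha) \<in> ?L"
      by (auto simp: columns_def)
    ultimately show ?thesis by blast
  qed
  show "?L \<subseteq> ?R"
  proof
    fix c assume c: "c \<in> ?L"
    have r: "c(b := None) \<in> columns A" using c b by (auto simp: columns_def)
    consider "c b = None" | "c b = Some Alpha" | "c b = Some Beta" | "c b = Some Delta"
      using label_cases[of "c b"] c by (auto simp: columns_def)
    then show "c \<in> ?R"
    proof cases
      case 1
      then have "c = c(b := None)" by auto
      with r show ?thesis by (metis UnI1)
    next
      case 2
      have "c i = None" if "i \<noteq> b" for i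
      proof (cases "i < b")
        case True
        with 2 c show ?thesis by (auto simp: columns_def)
      next
        case False
        then have "i \<notin> insert b A" using that assms by auto
        with c show ?thesis by (auto simp: columns_def)
      qed
      then have "c = (\<lambda>_. None)(b := Some Alpha)" using 2 by auto
      then show ?thesis by blast
    next
      case 3
      then have "c = (c(b := None))(b := Some Beta)" by auto
      then show ?thesis using r by (metis UnI1 UnI2 image_eqI)
    next
      case 4
      then have "c = (c(b := None))(b := Some Delta)" by auto
      then show ?thesis using r by (metis UnI1 UnI2 image_eqI)
    qed
  qed
qed

lemma column_outside: "c \<in> columns A \<Longrightarrow> b \<notin> A \<Longrightarrow> c b = None"
  by (simp add: columns_def)

lemma columns_empty: "columns {} = {\<lambda>_. None}"
  by (auto simp: columns_def)

lemma finite_columns: "finite A \<Longrightarrow> finite (columns A)"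
  by (induction A rule: finite_linorder_max_induct) (simp_all add: columns_empty columns_insert)

lemma sum_columns_insert:
  fixes f :: "(nat \<Rightarrow> label option) \<Rightarrow> 'a::comm_monoid_add"
  assumes fin: "finite A" and max: "\<forall>a\<in>A. a < b"
  shows "sum f (columns (insert b A)) =
    sum f (columns A) + (\<Sum>c\<in>columns A. f (c(b := Some Beta))) +
    (\<Sum>c\<in>columns A. f (c(b := Some Delta))) + f ((\<lambda>_. None)(b := Some Alpha))"
proof -
  have b: "b \<notin> A" using max by auto
  have inj: "inj_on (\<lambda>c. c(b := x)) (columns A)" for x
  proof (rule inj_onI)
    fix c d assume *: "c \<in> columns A" "d \<in> columns A" "c(b := x) = d(b := x)"
    then have "c(b := None) = d(b := None)" by (metis fun_upd_upd)
    moreover have "c(b := None) = c" "d(b := None) = d"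
      using * column_outside[OF _ b] by fastforce+
    ultimately show "c = d" by simp
  qed
  define B D where "B = (\<lambda>c. c(b := Some Beta)) ` columns A"
    and "D = (\<lambda>c. c(b := Some Delta)) ` columns A"
  have vals: "c \<in> columns A \<Longrightarrow> c b = None" "c \<in> B \<Longrightarrow> c b = Some Beta"
      "c \<in> D \<Longrightarrow> c b = Some Delta" for c
    using column_outside[OF _ b] by (auto simp: B_def D_def)
  have fins: "finite (columns A)" "finite B" "finite D"
    using fin by (simp_all add: finite_columns B_def D_def)
  have d1: "(\<lambda>_. None)(b := Some Alpha) \<notin> D"
    using vals(3) by fastforce
  have d2: "B \<inter> (D \<union> {(\<lambda>_. None)(b := Some Alpha)}) = {}"
    using vals(2,3) by fastforce
  have d3: "columns A \<inter> (B \<union> (D \<union> {(\<lambda>_. None)(b := Some Alpha)})) = {}"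
    using vals by fastforce
  have "sum f (columns (insert b A)) =
      sum f (columns A) + (sum f B + (sum f D + f ((\<lambda>_. None)(b := Some Alpha))))"
    unfolding columns_insert[OF max] B_def[symmetric] D_def[symmetric]
    using fins d1 d2 d3 by (simp add: sum.union_disjoint) (simp add: ac_simps)
  then show ?thesis
    by (simp add: B_def D_def sum.reindex[OF inj] add.assoc)
qed

lemma kept_rows_insert:
  assumes "finite A" "b \<notin> A" "c \<in> columns A"
  shows "card (kept_rows (insert b A) c) = Suc (card (kept_rows A c))"
    and "card (kept_rows (insert b A) (c(b := Some Beta))) = card (kept_rows A c)"
    and "card (kept_rows (insert b A) (c(b := Some Delta))) = card (kept_rows A c)"
proof -
  have "kept_rows (insert b A) c = insert b (kept_rows A c)"
    using column_outside[OF assms(3,2)] by (auto simp: kept_rows_def)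
  moreover have "finite (kept_rows A c)" "b \<notin> kept_rows A c"
    using assms by (auto simp: kept_rows_def)
  ultimately show "card (kept_rows (insert b A) c) = Suc (card (kept_rows A c))"
    by simp
  have "kept_rows (insert b A) (c(b := Some Beta)) = kept_rows A c"
    "kept_rows (insert b A) (c(b := Some Delta)) = kept_rows A c"
    using assms by (auto simp: kept_rows_def)
  then show "card (kept_rows (insert b A) (c(b := Some Beta))) = card (kept_rows A c)"
    "card (kept_rows (insert b A) (c(b := Some Delta))) = card (kept_rows A c)"
    by simp_all
qed

lemma kept_rows_alpha: "kept_rows A ((\<lambda>_. None)(b := Some Alpha)) = A"
  by (auto simp: kept_rows_def)

text \<open>
  With \<open>g r\<close> for the sum over the columns on \<open>r\<close> rows, \<open>columns_insert\<close> gives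
  \<open>g (r + 1) = (u + 2) g r + u ^ (r + 1)\<close>: an empty bottom box keeps its row (factor \<open>u\<close>), \<open>\<beta>\<close> and
  \<open>\<delta>\<close> lose it (factor \<open>1\<close> each), and \<open>\<alpha>\<close> keeps all \<open>r + 1\<close> rows. The factor 2 avoids a division.
\<close>
lemma sum_columns:
  fixes u :: "'a::comm_ring_1"
  assumes "finite A"
  shows "2 * (\<Sum>c\<in>columns A. u ^ card (kept_rows A c)) = (u + 2) ^ Suc (card A) - u ^ Suc (card A)"
  using assms
proof (induction A rule: finite_linorder_max_induct)
  case empty
  show ?case by (simp add: columns_empty kept_rows_def)
next
  case (insert b A)
  let ?S = "\<Sum>c\<in>columns A. u ^ card (kept_rows A c)"
  have b: "b \<notin> A" using insert.hyps by auto
  have "(\<Sum>c\<in>columns (insert b A). u ^ card (kept_rows (insert b A) c))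
      = u * ?S + ?S + ?S + u ^ Suc (card A)"
    using insert.hyps b
    by (simp add: sum_columns_insert kept_rows_insert kept_rows_alpha sum_distrib_left
        cong: sum.cong)
  then have "2 * (\<Sum>c\<in>columns (insert b A). u ^ card (kept_rows (insert b A) c))
      = (u + 2) * (2 * ?S) + 2 * u ^ Suc (card A)"
    by (simp add: algebra_simps)
  also have "\<dots> = (u + 2) ^ Suc (Suc (card A)) - u ^ Suc (Suc (card A))"
    unfolding insert.IH by (simp add: algebra_simps)
  finally show ?case using insert.hyps b by simp
qed

text \<open>
  Deleting the first column leaves a tableau of size \<open>n\<close> on the remaining part of the diagonal. The
  row rule for the deleted labels says exactly that they lie in free rows or in the new bottom row
  \<open>n\<close>, and the column rule involves the deleted column alone.
\<close>
lemma prepend_column_mem_iff: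
  "prepend_column c T \<in> gamma_free_tableaux (Suc n) \<longleftrightarrow>
    T \<in> gamma_free_tableaux n \<and> c \<in> columns (insert n (free_rows n T)) \<and> c n \<noteq> None"
  (is "?L \<longleftrightarrow> ?R")
proof
  assume L: ?L
  let ?P = "prepend_column c T"
  from L have out: "\<And>b. b \<notin> boxes (Suc n) \<Longrightarrow> ?P b = None"
    and diag: "\<And>b. b \<in> diagonal (Suc n) \<Longrightarrow> ?P b \<noteq> None"
    and row: "\<And>i j j'. ?P (i, j) \<in> {Some Beta, Some Delta} \<Longrightarrow> j' < j \<Longrightarrow> ?P (i, j') = None"
    and col: "\<And>i j i'. ?P (i, j) \<in> {Some Alpha, Some Gamma} \<Longrightarrow> i' < i \<Longrightarrow> ?P (i', j) = None"
    and gam: "\<And>b. ?P b \<noteq> Some Gamma"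
    unfolding gamma_free_tableaux_def staircase_tableaux_def by blast+
  have "T \<in> gamma_free_tableaux n"
  proof -
    have "T (i, j) = None" if "(i, j) \<notin> boxes n" for i j
      using out[of "(i, Suc j)"] that by (simp add: boxes_def)
    moreover have "T (i, j) \<noteq> None" if "(i, j) \<in> diagonal n" for i j
      using diag[of "(i, Suc j)"] that by (simp add: diagonal_def)
    moreover have "T (i, j') = None" if "T (i, j) \<in> {Some Beta, Some Delta}" "j' < j" for i j j'
      using row[of i "Suc j" "Suc j'"] that by simp
    moreover have "T (i', j) = None" if "T (i, j) \<in> {Some Alpha, Some Gamma}" "i' < i" for i j i'
      using col[of i "Suc j" i'] that by simp
    moreover have "T (i, j) \<noteq> Some Gamma" for i j
      using gam[of "(i, Suc j)"] by simp
    ultimately show ?thesis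
      unfolding gamma_free_tableaux_def staircase_tableaux_def by fast
  qed
  moreover have "c \<in> columns (insert n (free_rows n T))"
  proof -
    have "c i = None" if "i \<notin> insert n (free_rows n T)" for i
    proof (cases "i < n")
      case True
      with that obtain j where "T (i, j) \<in> {Some Beta, Some Delta}"
        by (auto simp: free_rows_def)
      then show ?thesis using row[of i "Suc j" 0] by simp
    next
      case False
      with that show ?thesis using out[of "(i, 0)"] by (simp add: boxes_def)
    qed
    moreover have "c i \<noteq> Some Gamma" for i
      using gam[of "(i, 0)"] by simp
    moreover have "c i' = None" if "c i = Some Alpha" "i' < i" for i i'
      using col[of i 0 i'] that by simp
    ultimately show ?thesis by (auto simp: columns_def)
  qed
  moreover have "c n \<noteq> None"
    using diag[of "(n, 0)"] by (simp add: diagonal_def)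
  ultimately show ?R by blast
next
  assume R: ?R
  then have out: "\<And>b. b \<notin> boxes n \<Longrightarrow> T b = None"
    and diag: "\<And>b. b \<in> diagonal n \<Longrightarrow> T b \<noteq> None"
    and row: "\<And>i j j'. T (i, j) \<in> {Some Beta, Some Delta} \<Longrightarrow> j' < j \<Longrightarrow> T (i, j') = None"
    and col: "\<And>i j i'. T (i, j) \<in> {Some Alpha, Some Gamma} \<Longrightarrow> i' < i \<Longrightarrow> T (i', j) = None"
    and gam: "\<And>b. T b \<noteq> Some Gamma"
    unfolding gamma_free_tableaux_def staircase_tableaux_def by blast+
  from R have cout: "\<And>i. i \<notin> insert n (free_rows n T) \<Longrightarrow> c i = None"
    and cgam: "\<And>i. c i \<noteq> Some Gamma"
    and ccol: "\<And>i i'. c i = Some Alpha \<Longrightarrow> i' < i \<Longrightarrow> c i' = None"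
    and cn: "c n \<noteq> None"
    unfolding columns_def by blast+
  let ?P = "prepend_column c T"
  have "?P (i, j) = None" if "(i, j) \<notin> boxes (Suc n)" for i j
    using that cout[of i] out[of "(i, j - 1)"]
    by (cases j) (auto simp: boxes_def free_rows_def)
  moreover have "?P (i, j) \<noteq> None" if "(i, j) \<in> diagonal (Suc n)" for i j
    using that cn diag[of "(i, j - 1)"]
    by (cases j) (auto simp: diagonal_def)
  moreover have "?P (i, j') = None" if labels: "?P (i, j) \<in> {Some Beta, Some Delta}" "j' < j" for i j j'
  proof -
    obtain k where k: "j = Suc k" using labels(2) by (cases j) auto
    show ?thesis
    proof (cases j')
      case 0
      have "i \<noteq> n"
        using labels(1) k out[of "(i, k)"] by (auto simp: boxes_def)
      moreover have "i \<notin> free_rows n T"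
        using labels(1) k by (auto simp: free_rows_def)
      ultimately show ?thesis using cout[of i] 0 by simp
    next
      case (Suc k')
      then show ?thesis using labels row[of i k k'] k by simp
    qed
  qed
  moreover have "?P (i', j) = None" if "?P (i, j) \<in> {Some Alpha, Some Gamma}" "i' < i" for i j i'
    using that ccol[of i i'] cgam[of i] col[of i "j - 1" i'] by (cases j) auto
  moreover have "?P (i, j) \<noteq> Some Gamma" for i j
    using gam cgam by (cases j) auto
  ultimately show ?L
    unfolding gamma_free_tableaux_def staircase_tableaux_def by fast
qed

lemma prepend_column_surj: "\<exists>c T. S = prepend_column c T"
proof -
  have "S = prepend_column (\<lambda>i. S (i, 0)) (\<lambda>(i, j). S (i, Suc j))"
    by (auto simp: prepend_column_def fun_eq_iff split: nat.split)
  then show ?thesis by blast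
qed

lemma prepend_column_inject:
  "prepend_column c T = prepend_column c' T' \<longleftrightarrow> c = c' \<and> T = T'"
proof
  assume *: "prepend_column c T = prepend_column c' T'"
  have "c i = c' i" for i
    using fun_cong[OF *, of "(i, 0)"] by simp
  moreover have "T (i, j) = T' (i, j)" for i j
    using fun_cong[OF *, of "(i, Suc j)"] by simp
  ultimately show "c = c' \<and> T = T'" by (simp add: fun_eq_iff)
qed simp

lemma bij_betw_prepend_column:
  "bij_betw (\<lambda>(T, c). prepend_column c T)
    (SIGMA T:gamma_free_tableaux n. {c \<in> columns (insert n (free_rows n T)). c n \<noteq> None})
    (gamma_free_tableaux (Suc n))"
  unfolding bij_betw_def
proof
  show "inj_on (\<lambda>(T, c). prepend_column c T)
    (SIGMA T:gamma_free_tableaux n. {c \<in> columns (insert n (free_rows n T)). c n \<noteq> None})"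
    by (auto simp: inj_on_def prepend_column_inject)
  show "(\<lambda>(T, c). prepend_column c T) `
      (SIGMA T:gamma_free_tableaux n. {c \<in> columns (insert n (free_rows n T)). c n \<noteq> None})
    = gamma_free_tableaux (Suc n)" (is "?I = _")
  proof
    show "?I \<subseteq> gamma_free_tableaux (Suc n)"
      by (auto simp: prepend_column_mem_iff)
    show "gamma_free_tableaux (Suc n) \<subseteq> ?I"
    proof
      fix S assume S: "S \<in> gamma_free_tableaux (Suc n)"
      obtain c T where "S = prepend_column c T" using prepend_column_surj by blast
      with S show "S \<in> ?I"
        by (force simp: prepend_column_mem_iff)
    qed
  qed
qed

lemma free_rows_prepend_column:
  assumes "T \<in> gamma_free_tableaux n"
  shows "free_rows (Suc n) (prepend_column c T) = kept_rows (insert n (free_rows n T)) c"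
proof -
  have out: "T (n, j) = None" for j
    using assms by (auto simp: gamma_free_tableaux_def staircase_tableaux_def boxes_def)
  have all: "(\<forall>j. P j) \<longleftrightarrow> P 0 \<and> (\<forall>j. P (Suc j))" for P :: "nat \<Rightarrow> bool"
    by (metis not0_implies_Suc)
  show ?thesis
    unfolding free_rows_def kept_rows_def
    by (subst all) (auto simp: less_Suc_eq out)
qed

lemma tableau_t_prepend_column:
  "tableau_t (Suc n) (prepend_column c T) =
    tableau_t n T + (if c n \<in> {Some Alpha, Some Delta} then 1 else 0)"
proof -
  let ?D = "{b \<in> diagonal n. T b \<in> {Some Alpha, Some Delta}}"
  let ?f = "\<lambda>(i, j). (i, Suc j) :: nat \<times> nat"
  have fin: "finite ?D"
    by (rule finite_subset[OF _ finite_boxes[of n]]) (auto simp: diagonal_def boxes_def)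
  have inj: "inj_on ?f ?D" by (auto simp: inj_on_def)
  have "{b \<in> diagonal (Suc n). prepend_column c T b \<in> {Some Alpha, Some Delta}} =
      ?f ` ?D \<union> (if c n \<in> {Some Alpha, Some Delta} then {(n, 0)} else {})" (is "?L = ?R")
  proof (rule set_eqI)
    fix b :: "nat \<times> nat"
    obtain i j where b: "b = (i, j)" by (cases b)
    show "b \<in> ?L \<longleftrightarrow> b \<in> ?R"
      unfolding b by (cases j) (auto simp: diagonal_def image_iff)
  qed
  then have "tableau_t (Suc n) (prepend_column c T) =
      card (?f ` ?D \<union> (if c n \<in> {Some Alpha, Some Delta} then {(n, 0)} else {}))"
    unfolding tableau_t_def by (rule arg_cong)
  also have "\<dots> = card (?f ` ?D) + card (if c n \<in> {Some Alpha, Some Delta} then {(n, 0 :: nat)} else {})"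
    by (rule card_Un_disjoint) (use fin in auto)
  also have "\<dots> = tableau_t n T + (if c n \<in> {Some Alpha, Some Delta} then 1 else 0)"
    unfolding tableau_t_def card_image[OF inj] by simp
  finally show ?thesis .
qed

section \<open>Recurrences for the refined partition function\<close>

text \<open>
  The partition function of the tableaux without \<open>\<gamma>\<close>, refined by a variable \<open>u\<close> that counts the free
  rows. The refinement is what makes the deletion of the first column a closed recurrence.
\<close>
definition row_refined_Z :: "nat \<Rightarrow> 'a::comm_ring_1 \<Rightarrow> 'a poly" where
  "row_refined_Z n u =
    (\<Sum>T\<in>gamma_free_tableaux n. monom (u ^ card (free_rows n T)) (tableau_t n T))"

text \<open>
  Sum over the label of the bottom box of the first column. A tableau with \<open>r\<close> free rows yields
  \<open>y u ^ (r + 1)\<close> for the label \<open>\<alpha>\<close>, and \<open>(1 + y)\<close> times the sum of \<open>sum_columns\<close> for \<open>\<beta>\<close> and \<open>\<delta>\<close>.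
  Twice the total is \<open>(1 + y) (u + 2) ^ (r + 1) - u (1 - y) u ^ r\<close>, in which \<open>r\<close> occurs only as an
  exponent; so the first term is a value of the partition function at \<open>u + 2\<close>.
\<close>
lemma row_refined_Z_shift:
  fixes u :: "'a::comm_ring_1"
  shows "2 * row_refined_Z (Suc n) u =
    [:u + 2, u + 2:] * row_refined_Z n (u + 2) - [:u, -u:] * row_refined_Z n u"
proof -
  define w where "w = (\<lambda>T c. monom (u ^ card (kept_rows (insert n (free_rows n T)) c))
      (tableau_t n T + (if c n \<in> {Some Alpha, Some Delta} then 1 else 0)))"
  have term_eq: "monom (u ^ card (free_rows (Suc n) (prepend_column c T)))
        (tableau_t (Suc n) (prepend_column c T)) = w T c"
    if "T \<in> gamma_free_tableaux n" for T c
    using that by (simp add: w_def free_rows_prepend_column tableau_t_prepend_column)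
  have fin: "finite {c \<in> columns (insert n (free_rows n T)). c n \<noteq> None}" for T
    by (simp add: finite_columns)
  have "row_refined_Z (Suc n) u =
    (\<Sum>(T, c)\<in>(SIGMA T:gamma_free_tableaux n. {c \<in> columns (insert n (free_rows n T)). c n \<noteq> None}).
      w T c)"
    unfolding row_refined_Z_def sum.reindex_bij_betw[OF bij_betw_prepend_column, symmetric]
    by (intro sum.cong) (auto simp: term_eq)
  also have "\<dots> = (\<Sum>T\<in>gamma_free_tableaux n.
      \<Sum>c\<in>{c \<in> columns (insert n (free_rows n T)). c n \<noteq> None}. w T c)"
    using fin by (intro sum.Sigma[symmetric]) auto
  finally have expand: "row_refined_Z (Suc n) u = \<dots>" .
  have inner: "2 * (\<Sum>c\<in>{c \<in> columns (insert n (free_rows n T)). c n \<noteq> None}. w T c) =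
      [:u + 2, u + 2:] * monom ((u + 2) ^ card (free_rows n T)) (tableau_t n T) -
      [:u, -u:] * monom (u ^ card (free_rows n T)) (tableau_t n T)" for T
  proof -
    define A where "A = free_rows n T"
    define t where "t = tableau_t n T"
    define S where "S = (\<Sum>c\<in>columns A. u ^ card (kept_rows A c))"
    have A: "finite A" "n \<notin> A" "\<forall>a\<in>A. a < n" by (auto simp: A_def free_rows_def)
    have cn: "c n = None" if "c \<in> columns A" for c using column_outside[OF that A(2)] .
    \<comment> \<open>Bottom boxes with \<open>\<beta>\<close> and \<open>\<delta>\<close> contribute this sum once without and once with an extra \<open>y\<close>.\<close>
    have sum_S: "(\<Sum>c\<in>columns A. monom (u ^ card (kept_rows A c)) k) = monom S k" for k
      unfolding S_def by (rule poly_eqI) (simp add: coeff_sum)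
    have "(\<Sum>c\<in>{c \<in> columns (insert n A). c n \<noteq> None}. w T c) =
        (\<Sum>c\<in>columns (insert n A). if c n \<noteq> None then w T c else 0)"
      using A by (simp add: sum.inter_filter finite_columns)
    also have "\<dots> = monom S t + monom S (Suc t) + monom (u ^ Suc (card A)) (Suc t)"
      using A
      by (simp add: sum_columns_insert cn w_def A_def[symmetric] t_def[symmetric]
          kept_rows_insert kept_rows_alpha sum_S cong: sum.cong)
    finally have "2 * (\<Sum>c\<in>{c \<in> columns (insert n A). c n \<noteq> None}. w T c) =
        monom (2 * S) t + monom (2 * S) (Suc t) + monom (2 * u ^ Suc (card A)) (Suc t)"
      by (simp add: poly_eq_iff numeral_poly)
    also have "2 * S = (u + 2) ^ Suc (card A) - u ^ Suc (card A)"
      unfolding S_def by (rule sum_columns[OF A(1)])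
    finally show ?thesis
      unfolding A_def[symmetric] t_def[symmetric]
      by (simp add: poly_eq_iff coeff_pCons algebra_simps split: nat.splits)
  qed
  show ?thesis
    unfolding expand
    by (subst sum_distrib_left)
      (simp only: inner row_refined_Z_def sum_subtractf flip: sum_distrib_left)
qed

lemma row_refined_Z_0: "row_refined_Z 0 u = 1"
proof -
  have "T = (\<lambda>_. None)" if "T \<in> gamma_free_tableaux 0" for T
  proof
    fix b :: "nat \<times> nat"
    have "\<forall>b. b \<notin> boxes 0 \<longrightarrow> T b = None"
      using that unfolding gamma_free_tableaux_def staircase_tableaux_def by blast
    then show "T b = None" by (cases b) (simp add: boxes_def)
  qed
  moreover have "(\<lambda>_. None) \<in> gamma_free_tableaux 0"
    by (simp add: gamma_free_tableaux_def staircase_tableaux_def diagonal_def)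
  ultimately have "gamma_free_tableaux 0 = {\<lambda>_. None}" by blast
  then show ?thesis
    by (simp add: row_refined_Z_def free_rows_def tableau_t_def diagonal_def)
qed

lemma fugacity_Z_eq:
  "fugacity_Z n 1 1 0 1 1 = row_refined_Z n (1 :: 'a::{comm_ring_1})"
proof -
  have w: "tableau_weight n 1 1 0 1 1 T = (if \<forall>b. T b \<noteq> Some Gamma then 1 else 0 :: 'a)"
    if T: "T \<in> staircase_tableaux n" for T
  proof (cases "\<forall>b. T b \<noteq> Some Gamma")
    case True
    have "box_weight 1 1 0 1 1 T b = (1 :: 'a)" for b
      using spec[OF True, of b]
      by (auto simp: box_weight_def blank_weight_def split: option.split label.split)
    then show ?thesis using True by (simp add: tableau_weight_def)
  next
    case False
    then obtain b where b: "T b = Some Gamma" by blast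
    have "T b = None" if "b \<notin> boxes n" using T that unfolding staircase_tableaux_def by blast
    with b have "b \<in> boxes n" by (metis option.distinct(1))
    moreover have "box_weight 1 1 0 1 1 T b = (0 :: 'a)" using b by (simp add: box_weight_def)
    ultimately have "tableau_weight n 1 1 0 1 1 T = (0 :: 'a)"
      unfolding tableau_weight_def by (intro prod_zero finite_boxes) blast
    then show ?thesis using False by simp
  qed
  have "fugacity_Z n 1 1 0 1 1 =
      (\<Sum>T\<in>staircase_tableaux n. if \<forall>b. T b \<noteq> Some Gamma then monom (1 :: 'a) (tableau_t n T) else 0)"
    unfolding fugacity_Z_def by (intro sum.cong) (simp_all add: w)
  also have "\<dots> = row_refined_Z n 1"
    by (simp add: row_refined_Z_def gamma_free_tableaux_def sum.inter_filter finite_staircase_tableaux)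
  finally show ?thesis .
qed

text \<open>
  The shift in \<open>u\<close> can be traded for a derivative in \<open>y\<close>. Let \<open>L\<^sub>n\<^sub>,\<^sub>u\<close> be the differential operator on
  the right-hand side. Then \<open>(1 + y) L\<^sub>n\<^sub>,\<^sub>u\<^sub>+\<^sub>2 f = L\<^sub>n\<^sub>+\<^sub>1\<^sub>,\<^sub>u ((1 + y) f)\<close> and
  \<open>(1 - y) L\<^sub>n\<^sub>,\<^sub>u f = L\<^sub>n\<^sub>+\<^sub>1\<^sub>,\<^sub>u ((1 - y) f)\<close>, so both terms of the shift recurrence pass from \<open>n\<close> to
  \<open>n + 1\<close> through the same operator, and the identity propagates by induction.
\<close>
lemma row_refined_Z_rec:
  fixes u :: "'a::{idom,ring_char_0}"
  shows "row_refined_Z (Suc n) u =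
    [:1, 1 + u + of_nat n, of_nat n:] * row_refined_Z n u +
    [:0, 1, 0, -1:] * pderiv (row_refined_Z n u)"
proof (induction n arbitrary: u)
  case 0
  have "2 * row_refined_Z (Suc 0) u = 2 * [:1, 1 + u:]"
    unfolding row_refined_Z_shift row_refined_Z_0 by (simp add: numeral_poly)
  then have "row_refined_Z (Suc 0) u = [:1, 1 + u:]" by (simp only: mult_cancel_left) simp
  then show ?case by (simp add: row_refined_Z_0)
next
  case (Suc n)
  define X U N :: "'a poly" where "X = [:0, 1:]" and "U = [:u:]" and "N = of_nat n"
  define P where "P = row_refined_Z n u"
  define Q where "Q = row_refined_Z (Suc n) u"
  define R where "R = row_refined_Z (Suc (Suc n)) u"
  define V where "V = row_refined_Z n (u + 2)"
  define W where "W = row_refined_Z (Suc n) (u + 2)"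
  have lin: "[:u + 2, u + 2:] = (U + 2) * (1 + X)" "[:u, -u:] = U * (1 - X)"
    "[:0, 1, 0, -1:] = X * (1 - X ^ 2)"
    "[:1, 1 + u + of_nat n, of_nat n:] = 1 + (1 + U + N) * X + N * X ^ 2"
    "[:1, 1 + (u + 2) + of_nat n, of_nat n:] = 1 + (3 + U + N) * X + N * X ^ 2"
    "[:1, 1 + u + of_nat (Suc n), of_nat (Suc n):] = 1 + (2 + U + N) * X + (N + 1) * X ^ 2"
    by (simp_all add: X_def U_def N_def of_nat_poly numeral_poly one_pCons power2_eq_square)
  have d: "pderiv X = 1" "pderiv U = 0"
    by (simp_all add: X_def U_def pderiv_pCons)
  have sQ: "2 * Q = (U + 2) * (1 + X) * V - U * (1 - X) * P"
    unfolding Q_def V_def P_def lin[symmetric] by (rule row_refined_Z_shift)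
  have sR: "2 * R = (U + 2) * (1 + X) * W - U * (1 - X) * Q"
    unfolding R_def W_def Q_def lin[symmetric] by (rule row_refined_Z_shift)
  have IQ: "Q = (1 + (1 + U + N) * X + N * X ^ 2) * P + X * (1 - X ^ 2) * pderiv P"
    unfolding Q_def P_def lin[symmetric] by (rule Suc.IH)
  have IW: "W = (1 + (3 + U + N) * X + N * X ^ 2) * V + X * (1 - X ^ 2) * pderiv V"
    unfolding W_def V_def lin[symmetric] by (rule Suc.IH)
  have "2 * pderiv Q = pderiv (2 * Q)"
    by (simp add: pderiv_mult)
  also have "\<dots> = (U + 2) * V + (U + 2) * (1 + X) * pderiv V + U * P - U * (1 - X) * pderiv P"
    unfolding sQ by (simp add: pderiv_diff pderiv_add pderiv_mult d algebra_simps)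
  finally have dQ: "2 * pderiv Q = \<dots>" .
  have "2 * R = 2 * ((1 + (2 + U + N) * X + (N + 1) * X ^ 2) * Q + X * (1 - X ^ 2) * pderiv Q)"
    using sQ sR IQ IW dQ by algebra
  then have "R = (1 + (2 + U + N) * X + (N + 1) * X ^ 2) * Q + X * (1 - X ^ 2) * pderiv Q"
    by (simp only: mult_cancel_left) simp
  then show ?case
    unfolding R_def Q_def lin[symmetric] .
qed

text \<open>
  The shift recurrence gives the leading coefficient at once, as a sum of positive terms; in the
  derivative recurrence a cancellation would have to be followed, because its coefficients have
  degrees 2 and 3.
\<close>
lemma degree_row_refined_Z:
  fixes u :: real
  assumes "u > 0"
  shows "degree (row_refined_Z n u) = n \<and> coeff (row_refined_Z n u) n > 0"
  using assms
proof (induction n arbitrary: u)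
  case 0
  show ?case by (simp add: row_refined_Z_0)
next
  case (Suc n)
  let ?R = "row_refined_Z (Suc n) u"
  have IH: "degree (row_refined_Z n v) = n" "coeff (row_refined_Z n v) n > 0" if "v > 0" for v :: real
    using Suc.IH[OF that] by auto
  have zero: "coeff (row_refined_Z n v) k = 0" if "v > 0" "k > n" for v :: real and k
    using that IH(1)[of v] by (simp add: coeff_eq_0)
  have coeff_Suc: "2 * coeff ?R (Suc k) =
      (u + 2) * (coeff (row_refined_Z n (u + 2)) (Suc k) + coeff (row_refined_Z n (u + 2)) k) -
      u * (coeff (row_refined_Z n u) (Suc k) - coeff (row_refined_Z n u) k)" for k
  proof -
    have "2 * coeff ?R (Suc k) = coeff (2 * ?R) (Suc k)" by (simp add: numeral_poly)
    then show ?thesis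
      unfolding row_refined_Z_shift by (simp add: algebra_simps)
  qed
  have "2 * coeff ?R (Suc n) > 0"
    unfolding coeff_Suc using Suc.prems IH(2)[of u] IH(2)[of "u + 2"]
    by (simp add: zero add_pos_pos)
  moreover have "coeff ?R k = 0" if "k > Suc n" for k
    using that coeff_Suc[of "k - 1"] Suc.prems by (simp add: zero)
  then have "degree ?R \<le> Suc n" by (simp add: degree_le)
  ultimately show ?case by (simp add: le_degree order_antisym)
qed

lemma map_poly_row_refined_Z:
  "map_poly complex_of_real (row_refined_Z n u) = row_refined_Z n (complex_of_real u)"
  by (rule poly_eqI) (simp add: coeff_map_poly row_refined_Z_def coeff_sum if_distrib cong: if_cong)

section \<open>Location of the roots\<close>

text \<open>
  Multiplied by \<open>1 - w\<^sup>2\<close>, the logarithmic derivative of \<open>p\<close> is the sum of \<open>(1 - w\<^sup>2) / (w - r)\<close> over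
  the roots. Each of the \<open>size M\<close> terms absorbs one \<open>1 + w\<close>, as
  \<open>1 + w + (1 - w\<^sup>2) / (w - r) = (1 + w) (1 - r) / (w - r)\<close>.
\<close>
lemma log_derivative_identity:
  fixes w :: "'a::field"
  assumes "w \<notin># M"
  defines "p \<equiv> \<Prod>r\<in>#M. [:-r, 1:]"
  shows "of_nat (size M) * (1 + w) * poly p w + (1 - w\<^sup>2) * poly (pderiv p) w =
    poly p w * (\<Sum>r\<in>#M. (1 + w) * (1 - r) / (w - r))"
  using assms(1) unfolding p_def
proof (induction M)
  case empty
  show ?case by simp
next
  case (add r M)
  let ?p = "\<Prod>r\<in>#M. [:-r, 1:]" and ?S = "\<Sum>r\<in>#M. (1 + w) * (1 - r) / (w - r)"
  have wr: "w - r \<noteq> 0" and IH: "of_nat (size M) * (1 + w) * poly ?p w + (1 - w\<^sup>2) * poly (pderiv ?p) w =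
      poly ?p w * ?S"
    using add by auto
  have pd: "poly (pderiv (\<Prod>r\<in>#add_mset r M. [:-r, 1:])) w =
      poly ?p w + (w - r) * poly (pderiv ?p) w"
    unfolding image_mset_add_mset prod_mset.add_mset pderiv_mult
    by (simp add: pderiv_pCons algebra_simps)
  have "of_nat (size (add_mset r M)) * (1 + w) * poly (\<Prod>r\<in>#add_mset r M. [:-r, 1:]) w +
      (1 - w\<^sup>2) * poly (pderiv (\<Prod>r\<in>#add_mset r M. [:-r, 1:])) w =
      (w - r) * (of_nat (size M) * (1 + w) * poly ?p w + (1 - w\<^sup>2) * poly (pderiv ?p) w)
      + poly ?p w * ((1 + w) * (1 - r))"
    unfolding pd by (simp add: algebra_simps power2_eq_square)
  also have "\<dots> = (w - r) * poly ?p w * (?S + (1 + w) * (1 - r) / (w - r))"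
    unfolding IH using wr by (simp add: field_simps)
  finally show ?case by (simp add: algebra_simps)
qed

text \<open>
  Let \<open>q\<close> be the polynomial on the right-hand side of the recurrence. Where \<open>p z \<noteq> 0\<close> and \<open>z \<noteq> 0\<close>, the
  preceding identity yields
  \<open>q z / (z p z) = 1 / z + 1 + u + (\<Sum>r. (1 + z) (1 - r) / (z - r))\<close>,
  since the degree of \<open>p\<close> is exactly \<open>n\<close>. For roots \<open>r\<close> in \<open>]-1, 0[\<close> this cannot vanish outside that
  interval. Off the real line, each summand equals \<open>(1 - r) + (1 - r\<^sup>2) / (z - r)\<close>, whose imaginary
  part has the sign opposite to that of \<open>Im z\<close>, as has that of \<open>1 / z\<close>. At a real \<open>z\<close> with \<open>z \<le> -1\<close> or
  \<open>z > 0\<close>, the numbers \<open>1 / z + 1\<close> and \<open>(1 + z) / (z - r)\<close> are nonnegative, and \<open>u > 0\<close>.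
\<close>
lemma roots_in_interval_step:
  fixes p :: "complex poly" and u :: real
  assumes "p \<noteq> 0" "degree p = n" and "u > 0"
    and roots: "\<And>z. poly p z = 0 \<Longrightarrow> \<exists>x::real. z = complex_of_real x \<and> -1 < x \<and> x < 0"
    and z: "poly ([:1, 1 + complex_of_real u + of_nat n, of_nat n:] * p +
      [:0, 1, 0, -1:] * pderiv p) z = 0"
  shows "\<exists>x::real. z = complex_of_real x \<and> -1 < x \<and> x < 0"
proof (rule ccontr)
  assume contra: "\<not> ?thesis"
  then have pz: "poly p z \<noteq> 0" using roots by blast
  define M where "M = proots p"
  define S where "S = (\<Sum>r\<in>#M. (1 + z) * (1 - r) / (z - r))"
  have M: "\<exists>x::real. r = complex_of_real x \<and> -1 < x \<and> x < 0" if "r \<in># M" for r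
    using that roots \<open>p \<noteq> 0\<close> by (simp add: M_def)
  have zM: "z \<notin># M" using contra M by blast
  have decomp: "p = smult (lead_coeff p) (\<Prod>r\<in>#M. [:-r, 1:])"
    unfolding M_def by (rule complex_poly_decompose_multiset[symmetric])
  have size: "size M = n"
    using \<open>degree p = n\<close> by (simp add: M_def size_proots_complex)
  have ident: "of_nat n * (1 + z) * poly p z + (1 - z\<^sup>2) * poly (pderiv p) z = poly p z * S"
  proof -
    let ?q = "\<Prod>r\<in>#M. [:-r, 1:]"
    have "of_nat n * (1 + z) * poly p z + (1 - z\<^sup>2) * poly (pderiv p) z =
        lead_coeff p * (of_nat (size M) * (1 + z) * poly ?q z + (1 - z\<^sup>2) * poly (pderiv ?q) z)"
      unfolding size by (subst (1 2) decomp) (simp add: pderiv_smult algebra_simps)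
    also have "\<dots> = lead_coeff p * poly ?q z * S"
      unfolding log_derivative_identity[OF zM] S_def by simp
    also have "lead_coeff p * poly ?q z = poly p z"
      by (subst (2) decomp) simp
    finally show ?thesis .
  qed
  have "z \<noteq> 0"
    using z pz by auto
  have "poly p z * (1 + z * (1 + complex_of_real u)) +
      z * (of_nat n * (1 + z) * poly p z + (1 - z\<^sup>2) * poly (pderiv p) z) = 0"
    using z by (simp add: algebra_simps power2_eq_square)
  then have "poly p z * (1 + z * (1 + complex_of_real u) + z * S) = 0"
    unfolding ident by (simp add: algebra_simps)
  then have "1 + z * (1 + complex_of_real u) + z * S = 0" using pz by simp
  then have main: "1 / z + 1 + complex_of_real u + S = 0"
    using \<open>z \<noteq> 0\<close> by (simp add: field_simps)
  show False
  proof (cases "Im z = 0")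
    case False
    have "Im S * Im z \<le> 0"
    proof -
      have "Im ((1 + z) * (1 - r) / (z - r)) * Im z \<le> 0" if r: "r \<in># M" for r
      proof -
        obtain x where x: "r = complex_of_real x" "-1 < x" "x < 0" using M[OF r] by blast
        have "z - r \<noteq> 0" using r zM by auto
        then have "(1 + z) * (1 - r) / (z - r) = (1 - r) + (1 - r) * (1 + r) / (z - r)"
          by (simp add: field_simps)
        also have "\<dots> = complex_of_real (1 - x) +
            complex_of_real ((1 - x) * (1 + x)) / (z - complex_of_real x)"
          by (simp add: x(1))
        finally have "Im ((1 + z) * (1 - r) / (z - r)) =
            - ((1 - x) * (1 + x)) * Im z / ((Re z - x)\<^sup>2 + (Im z)\<^sup>2)"
          by (simp only: plus_complex.simps Im_complex_of_real Im_divide) simp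
        then have "Im ((1 + z) * (1 - r) / (z - r)) * Im z =
            - (((1 - x) * (1 + x)) * (Im z)\<^sup>2 / ((Re z - x)\<^sup>2 + (Im z)\<^sup>2))"
          by (simp add: power2_eq_square)
        also have "\<dots> \<le> 0" using x by simp
        finally show ?thesis .
      qed
      then show ?thesis
        unfolding S_def by (induction M) (auto simp: distrib_right intro: add_nonpos_nonpos)
    qed
    moreover have "Im (1 / z) * Im z < 0"
    proof -
      have "Im (1 / z) * Im z = - ((Im z)\<^sup>2 / ((Re z)\<^sup>2 + (Im z)\<^sup>2))"
        by (simp add: Im_divide power2_eq_square)
      also have "\<dots> < 0" using False by (simp add: add_nonneg_pos)
      finally show ?thesis .
    qed
    moreover have "Im (1 / z) * Im z + Im S * Im z = Im (1 / z + 1 + complex_of_real u + S) * Im z"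
      by (simp add: distrib_right)
    ultimately show False unfolding main by simp
  next
    case True
    then obtain y where y: "z = complex_of_real y" by (metis complex_is_Real_iff Reals_cases)
    with contra have out: "y \<le> -1 \<or> 0 \<le> y" by auto
    with \<open>z \<noteq> 0\<close> y have y0: "y \<le> -1 \<or> 0 < y" by force
    have "Re S \<ge> 0"
    proof -
      have "Re ((1 + z) * (1 - r) / (z - r)) \<ge> 0" if r: "r \<in># M" for r
      proof -
        obtain x where x: "r = complex_of_real x" "-1 < x" "x < 0" using M[OF r] by blast
        have "(1 + z) * (1 - r) / (z - r) = complex_of_real ((1 + y) * (1 - x) / (y - x))"
          by (simp add: x(1) y)
        moreover have "(1 + y) * (1 - x) / (y - x) \<ge> 0"
          using y0 x by (auto simp: zero_le_divide_iff mult_nonneg_nonneg mult_nonpos_nonneg)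
        ultimately show ?thesis by (metis Re_complex_of_real)
      qed
      then show ?thesis
        unfolding S_def by (induction M) auto
    qed
    moreover have "1 / y + 1 \<ge> 0" using y0 by (auto simp: field_simps)
    moreover have "Re (1 / z + 1 + complex_of_real u + S) = 1 / y + 1 + u + Re S"
      by (simp add: y)
    ultimately show False unfolding main using \<open>u > 0\<close> by simp
  qed
qed

lemma row_refined_Z_roots:
  fixes u :: real
  assumes "u > 0" and "poly (row_refined_Z n (complex_of_real u)) z = 0"
  shows "\<exists>x::real. z = complex_of_real x \<and> -1 < x \<and> x < 0"
  using assms(2)
proof (induction n arbitrary: z)
  case 0
  then show ?case by (simp add: row_refined_Z_0)
next
  case (Suc n)
  have deg: "degree (row_refined_Z n (complex_of_real u)) = n"
    using degree_row_refined_Z[OF \<open>u > 0\<close>, of n]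
    by (simp add: degree_map_poly flip: map_poly_row_refined_Z)
  have "row_refined_Z n u \<noteq> 0"
    using degree_row_refined_Z[OF \<open>u > 0\<close>, of n] by auto
  then have "row_refined_Z n (complex_of_real u) \<noteq> 0"
    by (simp add: map_poly_eq_0_iff flip: map_poly_row_refined_Z)
  from this deg \<open>u > 0\<close> Suc.IH Suc.prems show ?case
    unfolding row_refined_Z_rec by (rule roots_in_interval_step)
qed

section \<open>Log-concavity of polynomials with negative roots\<close>

lemma map_poly_of_real_mult:
  "map_poly complex_of_real (p * q) = map_poly complex_of_real p * map_poly complex_of_real q"
  by (rule poly_eqI) (simp add: coeff_map_poly coeff_mult)

lemma map_poly_of_real_inject:
  assumes "map_poly complex_of_real p = map_poly complex_of_real q"
  shows "p = q"
proof (rule poly_eqI)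
  fix k
  have "coeff (map_poly complex_of_real p) k = coeff (map_poly complex_of_real q) k"
    using assms by simp
  then show "coeff p k = coeff q k" by (simp add: coeff_map_poly)
qed

text \<open>
  The factorization of the complexified polynomial descends to the reals, because all its linear
  factors are real.
\<close>
lemma real_poly_decompose:
  fixes p :: "real poly"
  assumes real: "\<And>z. poly (map_poly complex_of_real p) z = 0 \<Longrightarrow> z \<in> \<real>"
  shows "p = smult (lead_coeff p) (\<Prod>z\<in>#proots (map_poly complex_of_real p). [:-Re z, 1:])"
proof (cases "p = 0")
  case False
  define q where "q = map_poly complex_of_real p"
  have q: "q \<noteq> 0" using False by (simp add: q_def map_poly_eq_0_iff)
  have hom: "map_poly complex_of_real (\<Prod>z\<in>#M. [:-Re z, 1:]) = (\<Prod>z\<in>#M. [:-z, 1:])"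
    if "\<And>z. z \<in># M \<Longrightarrow> z \<in> \<real>" for M
    using that
  proof (induction M)
    case (add x M)
    then show ?case
      unfolding image_mset_add_mset prod_mset.add_mset map_poly_of_real_mult
      by (simp add: map_poly_pCons)
  qed simp
  have "z \<in> \<real>" if "z \<in># proots q" for z
    using that real q by (simp add: q_def)
  then have "map_poly complex_of_real (smult (lead_coeff p) (\<Prod>z\<in>#proots q. [:-Re z, 1:])) =
      smult (complex_of_real (lead_coeff p)) (\<Prod>z\<in>#proots q. [:-z, 1:])"
    by (simp add: map_poly_smult hom)
  also have "complex_of_real (lead_coeff p) = lead_coeff q"
    by (simp add: q_def coeff_map_poly degree_map_poly)
  also have "smult \<dots> (\<Prod>z\<in>#proots q. [:-z, 1:]) = map_poly complex_of_real p"
    by (simp only: complex_poly_decompose_multiset q_def)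
  finally show ?thesis
    unfolding q_def by (rule map_poly_of_real_inject[OF sym])
qed simp

lemma log_concave_poly_iff:
  "log_concave_poly p \<longleftrightarrow> (\<forall>k. coeff p k \<ge> 0) \<and>
    (\<forall>k. (coeff p (Suc k))\<^sup>2 \<ge> coeff p k * coeff p (Suc (Suc k)))"
proof -
  have "(\<forall>k\<ge>1. P k) \<longleftrightarrow> (\<forall>k. P (Suc k))" for P :: "nat \<Rightarrow> bool"
    by (metis Suc_le_D One_nat_def le_numeral_extra(4) Suc_le_mono le0)
  then show ?thesis by (simp add: log_concave_poly_def)
qed

text \<open>
  The difference that has to be nonnegative for \<open>(a + X) p\<close> is a quadratic polynomial in \<open>a\<close>. Its
  outer coefficients are differences of the same kind for \<open>p\<close>; the middle one is nonnegative if
  \<open>c k * c (k + 3) \<le> c (k + 1) * c (k + 2)\<close>, which is the product of two neighbouring inequalities for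
  \<open>p\<close> after cancellation. Cancelling requires that the sequence has no internal zeros, so this
  property is carried along.
\<close>
lemma log_concave_linear_factor:
  assumes lc: "log_concave_poly p" and supp: "\<And>k. coeff p (Suc k) > 0 \<Longrightarrow> coeff p k > 0"
    and "a > 0"
  shows "log_concave_poly ([:a, 1:] * p)"
    and "coeff ([:a, 1:] * p) (Suc k) > 0 \<Longrightarrow> coeff ([:a, 1:] * p) k > 0"
proof -
  define c where "c = coeff p"
  have c0: "c k \<ge> 0" and c2: "c k * c (Suc (Suc k)) \<le> (c (Suc k))\<^sup>2"
    and cs: "c (Suc k) > 0 \<Longrightarrow> c k > 0" for k
    using lc supp by (auto simp: c_def log_concave_poly_iff)
  have q0: "coeff ([:a, 1:] * p) 0 = a * c 0"
    and qS: "coeff ([:a, 1:] * p) (Suc k) = c k + a * c (Suc k)" for k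
    by (simp_all add: c_def)
  have nonneg: "coeff ([:a, 1:] * p) k \<ge> 0" for k
    by (cases k) (simp_all only: q0 qS, use c0 \<open>a > 0\<close> in simp_all)
  have c3: "c k * c (Suc (Suc (Suc k))) \<le> c (Suc k) * c (Suc (Suc k))" for k
  proof (cases "c (Suc (Suc k)) = 0")
    case True
    then have "c (Suc (Suc (Suc k))) = 0"
      using cs[of "Suc (Suc k)"] c0[of "Suc (Suc (Suc k))"] by force
    then show ?thesis using c0 by simp
  next
    case False
    then have p2: "c (Suc (Suc k)) > 0" using c0[of "Suc (Suc k)"] by simp
    then have p1: "c (Suc k) > 0" by (rule cs)
    have "(c k * c (Suc (Suc (Suc k)))) * (c (Suc k) * c (Suc (Suc k))) =
        (c k * c (Suc (Suc k))) * (c (Suc k) * c (Suc (Suc (Suc k))))"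
      by (simp add: mult_ac)
    also have "\<dots> \<le> (c (Suc k))\<^sup>2 * (c (Suc (Suc k)))\<^sup>2"
      by (intro mult_mono c2) (simp_all add: c0)
    also have "\<dots> = (c (Suc k) * c (Suc (Suc k))) * (c (Suc k) * c (Suc (Suc k)))"
      by (simp add: power2_eq_square mult_ac)
    finally show ?thesis using p1 p2 by simp
  qed
  have "coeff ([:a, 1:] * p) k * coeff ([:a, 1:] * p) (Suc (Suc k)) \<le> (coeff ([:a, 1:] * p) (Suc k))\<^sup>2" for k
  proof (cases k)
    case 0
    have "0 \<le> c 0 ^ 2 + a * (c 0 * c 1) + a ^ 2 * ((c 1)\<^sup>2 - c 0 * c 2)"
      using c0 c2[of 0] \<open>a > 0\<close> by (simp add: numeral_2_eq_2)
    then show ?thesis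
      unfolding 0 q0 qS by (simp add: numeral_2_eq_2 algebra_simps)
  next
    case (Suc m)
    have "0 \<le> ((c (Suc m))\<^sup>2 - c m * c (Suc (Suc m))) +
        a * (c (Suc m) * c (Suc (Suc m)) - c m * c (Suc (Suc (Suc m)))) +
        a ^ 2 * ((c (Suc (Suc m)))\<^sup>2 - c (Suc m) * c (Suc (Suc (Suc m))))"
      using c2[of m] c3[of m] c2[of "Suc m"] \<open>a > 0\<close> by simp
    then show ?thesis
      unfolding Suc qS by (simp add: algebra_simps power2_eq_square)
  qed
  with nonneg show "log_concave_poly ([:a, 1:] * p)"
    unfolding log_concave_poly_iff by blast
  assume *: "coeff ([:a, 1:] * p) (Suc k) > 0"
  have ck: "c k > 0"
  proof (rule ccontr)
    assume "\<not> c k > 0"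
    then have "c k = 0" "c (Suc k) = 0"
      using cs[of k] c0[of k] c0[of "Suc k"] by force+
    then show False using * unfolding qS by simp
  qed
  show "coeff ([:a, 1:] * p) k > 0"
    by (cases k) (use ck c0 \<open>a > 0\<close> in \<open>simp_all only: q0 qS, simp_all add: add_nonneg_pos\<close>)
qed

lemma log_concave_of_negative_roots:
  fixes p :: "real poly"
  assumes "lead_coeff p > 0"
    and roots: "\<And>z. poly (map_poly complex_of_real p) z = 0 \<Longrightarrow>
      \<exists>x::real. z = complex_of_real x \<and> x < 0"
  shows "log_concave_poly p"
proof -
  define M where "M = proots (map_poly complex_of_real p)"
  have "map_poly complex_of_real p \<noteq> 0"
    using \<open>lead_coeff p > 0\<close> by (auto simp: map_poly_eq_0_iff)
  then have M: "Re z < 0" if "z \<in># M" for z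
    using that roots[of z] by (auto simp: M_def)
  let ?q = "\<Prod>z\<in>#M. [:-Re z, 1:]"
  have "log_concave_poly ?q \<and> (\<forall>k. coeff ?q (Suc k) > 0 \<longrightarrow> coeff ?q k > 0)"
    using M
  proof (induction M)
    case empty
    then show ?case by (simp add: log_concave_poly_iff)
  next
    case (add z M)
    have eq: "(\<Prod>z\<in>#add_mset z M. [:-Re z, 1:]) = [:-Re z, 1:] * (\<Prod>z\<in>#M. [:-Re z, 1:])"
      by simp
    have "- Re z > 0" using add.prems[of z] by simp
    moreover have "log_concave_poly (\<Prod>z\<in>#M. [:-Re z, 1:])"
      "\<And>k. coeff (\<Prod>z\<in>#M. [:-Re z, 1:]) (Suc k) > 0 \<Longrightarrow> coeff (\<Prod>z\<in>#M. [:-Re z, 1:]) k > 0"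
      using add by auto
    ultimately show ?case
      unfolding eq using log_concave_linear_factor by blast
  qed
  then have "log_concave_poly (smult (lead_coeff p) ?q)"
  proof -
    assume q: "log_concave_poly ?q \<and> (\<forall>k. coeff ?q (Suc k) > 0 \<longrightarrow> coeff ?q k > 0)"
    have "(lead_coeff p)\<^sup>2 * (coeff ?q k * coeff ?q (Suc (Suc k))) \<le>
        (lead_coeff p)\<^sup>2 * (coeff ?q (Suc k))\<^sup>2" for k
      using q by (intro mult_left_mono) (auto simp: log_concave_poly_iff)
    with q \<open>lead_coeff p > 0\<close> show ?thesis
      by (simp add: log_concave_poly_iff power_mult_distrib power2_eq_square mult_ac)
  qed
  also have "smult (lead_coeff p) ?q = p"
    unfolding M_def by (rule real_poly_decompose[symmetric]) (use roots in force)
  finally show ?thesis .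
qed

section \<open>Roots, stability and log-concavity of the fugacity partition function\<close>

theorem proposition2p3:
  fixes n :: nat
  assumes "n \<ge> 1"
  defines "Z \<equiv> (fugacity_Z n 1 1 0 1 1 :: real poly)"
  shows "(\<forall>z::complex. poly (map_poly complex_of_real Z) z = 0 \<longrightarrow>
            (\<exists>x::real. z = complex_of_real x \<and> -1 < x \<and> x < 0)) \<and>
         stable_poly (map_poly complex_of_real Z) \<and>
         log_concave_poly Z"
proof -
  have Z: "Z = row_refined_Z n 1"
    unfolding Z_def by (rule fugacity_Z_eq)
  have roots: "\<exists>x::real. z = complex_of_real x \<and> -1 < x \<and> x < 0"
    if "poly (map_poly complex_of_real Z) z = 0" for z
    using that unfolding Z map_poly_row_refined_Z
    by (intro row_refined_Z_roots[of 1 n]) simp_all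
  moreover have "stable_poly (map_poly complex_of_real Z)"
    unfolding stable_poly_def using roots by fastforce
  moreover have "log_concave_poly Z"
  proof (rule log_concave_of_negative_roots)
    show "lead_coeff Z > 0"
      using degree_row_refined_Z[of 1 n] by (simp add: Z)
  qed (use roots in blast)
  ultimately show ?thesis by blast
qed

end
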